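(* Let $A$ and $B$ be Archimedean $f$-algebras with $B$ relatively uniformly complete, and let $T:A\to B$ be an order bounded linear operator. Then $T$ is an algebra homomorphism if and only if $\overline{T}:\overline{A}\to B$ is an algebra homomorphism.
   Context: All spaces are real. A Riesz algebra is a Riesz space with an associative algebra multiplication such that products of positive elements are positive. It is an $f$-algebra if $a\wedge b=0$ implies $ac\wedge b=ca\wedge b=0$ for all $c\ge 0$. A Riesz space is relatively uniformly complete if every relatively uniformly Cauchy sequence converges relatively uniformly. For an Archimedean Riesz space $A$, the relatively uniform completion $\overline{A}$ is the closure of $A$, in its Dedekind completion, with respect to the relatively uniform topology (whose closed sets are those containing all limits of their relatively uniformly convergent sequences). If $A$ is an $f$-algebra, $\overline{A}$ carries the unique lattice ordered algebra multiplication extending that of $A$, so that $A$ is a subalgebra of $\overline A$ and $\overline{A}$ is a relatively uniformly complete $f$-algebra. For an order bounded linear operator $T:A\to B$ into a relatively uniformly complete Archimedean $B$, $\overline{T}:\overline{A}\to B$ denotes its unique order bounded (hence relatively uniformly continuous) linear extension; when $T$ is positive, $\overline{T}(x)=\sup\{T(a):a\in A,\ 0\le a\le x\}$ for $0\le x\in\overline{A}$. *)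

theory Defs
  imports "HOL-Analysis.Analysis" "HOL-Library.Lattice_Algebras"
begin

section \<open>Riesz spaces and relatively uniform convergence\<close>

class riesz_space = ordered_real_vector + lattice_ab_group_add_abs
begin

definition ru_converges :: "(nat \<Rightarrow> 'a) \<Rightarrow> 'a \<Rightarrow> bool" where
  "ru_converges X x \<longleftrightarrow>
    (\<exists>u\<ge>0. \<forall>\<epsilon>>0. \<exists>N. \<forall>n\<ge>N. \<bar>X n - x\<bar> \<le> \<epsilon> *\<^sub>R u)"

definition ru_Cauchy :: "(nat \<Rightarrow> 'a) \<Rightarrow> bool" where
  "ru_Cauchy X \<longleftrightarrow>
    (\<exists>u\<ge>0. \<forall>\<epsilon>>0. \<exists>N. \<forall>m\<ge>N. \<forall>n\<ge>N. \<bar>X m - X n\<bar> \<le> \<epsilon> *\<^sub>R u)"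

text \<open>The closed sets of the relatively uniform topology; the closure of \<open>S\<close> is
  \<open>ru_closed hull S\<close>, which may be larger than the set of limits of sequences in \<open>S\<close>.\<close>

definition ru_closed :: "'a set \<Rightarrow> bool" where
  "ru_closed S \<longleftrightarrow> (\<forall>X x. (\<forall>n. X n \<in> S) \<longrightarrow> ru_converges X x \<longrightarrow> x \<in> S)"

end

class archimedean_riesz_space = riesz_space +
  assumes archimedean: "0 \<le> x \<Longrightarrow> (\<And>n::nat. real n *\<^sub>R x \<le> y) \<Longrightarrow> x = 0"

class ru_complete_riesz_space = riesz_space +
  assumes ru_complete: "ru_Cauchy X \<Longrightarrow> \<exists>x. ru_converges X x"

section \<open>Riesz algebras and f-algebras\<close>

text \<open>Algebras are associative but need be neither unital nor commutative. The monotonicity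
  axioms of \<^class>\<open>lattice_ring\<close> say that products of positive elements are positive.\<close>

class riesz_algebra = riesz_space + real_algebra + lattice_ring

class f_algebra = riesz_algebra +
  assumes f_algebra_right: "inf a b = 0 \<Longrightarrow> 0 \<le> c \<Longrightarrow> inf (a * c) b = 0"
    and f_algebra_left: "inf a b = 0 \<Longrightarrow> 0 \<le> c \<Longrightarrow> inf (c * a) b = 0"

section \<open>Operators\<close>

definition order_bounded :: "('a::riesz_space \<Rightarrow> 'b::riesz_space) \<Rightarrow> bool" where
  "order_bounded T \<longleftrightarrow> (\<forall>u v. \<exists>l w. T ` {u..v} \<subseteq> {l..w})"

definition algebra_hom :: "('a::real_algebra \<Rightarrow> 'b::real_algebra) \<Rightarrow> bool" where
  "algebra_hom T \<longleftrightarrow> linear T \<and> (\<forall>x y. T (x * y) = T x * T y)"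

definition riesz_embedding :: "('a::riesz_space \<Rightarrow> 'b::riesz_space) \<Rightarrow> bool" where
  "riesz_embedding f \<longleftrightarrow> linear f \<and> inj f \<and>
    (\<forall>x y. f (sup x y) = sup (f x) (f y)) \<and> (\<forall>x y. f (inf x y) = inf (f x) (f y))"

section \<open>Completions\<close>

text \<open>A Dedekind completion of \<open>'a\<close> is a Dedekind complete Riesz space in which \<open>'a\<close> is
  embedded as an order dense and majorizing Riesz subspace.\<close>

definition dedekind_completion ::
    "('a::riesz_space \<Rightarrow> 'd::{riesz_space, conditionally_complete_lattice}) \<Rightarrow> bool" where
  "dedekind_completion j \<longleftrightarrow> riesz_embedding j \<and>
    (\<forall>x>0. \<exists>a. 0 < j a \<and> j a \<le> x) \<and> (\<forall>x. \<exists>a. x \<le> j a)"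

text \<open>The chain \<open>i :: 'a \<Rightarrow> 'c\<close>, \<open>e :: 'c \<Rightarrow> 'd\<close> exhibits the type \<open>'c\<close> as the relatively uniform
  closure of \<open>'a\<close> in its Dedekind completion \<open>'d\<close>. Sequences and regulators are taken
  in \<open>'d\<close>.\<close>

definition ru_completion ::
    "('a::riesz_space \<Rightarrow> 'c::riesz_space) \<Rightarrow>
     ('c \<Rightarrow> 'd::{riesz_space, conditionally_complete_lattice}) \<Rightarrow> bool" where
  "ru_completion i e \<longleftrightarrow> dedekind_completion (e \<circ> i) \<and> riesz_embedding e \<and>
    range e = ru_closed hull range (e \<circ> i)"

text \<open>For f-algebras, the multiplication of \<open>'c\<close> is a lattice ordered algebra multiplication
  which extends that of \<open>'a\<close>.\<close>

definition ru_completion_algebra ::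
    "('a::f_algebra \<Rightarrow> 'c::riesz_algebra) \<Rightarrow>
     ('c \<Rightarrow> 'd::{riesz_space, conditionally_complete_lattice}) \<Rightarrow> bool" where
  "ru_completion_algebra i e \<longleftrightarrow> ru_completion i e \<and> (\<forall>a b. i (a * b) = i a * i b)"

definition order_bounded_extension ::
    "('a::riesz_space \<Rightarrow> 'c::riesz_space) \<Rightarrow> ('a \<Rightarrow> 'b::riesz_space) \<Rightarrow> ('c \<Rightarrow> 'b) \<Rightarrow> bool" where
  "order_bounded_extension i T S \<longleftrightarrow> linear S \<and> order_bounded S \<and> S \<circ> i = T"

end

theory Submission
  imports Defs
begin

text \<open>
  The proof rests on one principle (\<open>order_bounded_linear_eqI\<close>): two order bounded linear maps
  from the relatively uniform completion into an Archimedean Riesz space that agree on the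
  original space are equal. Indeed, order bounded linear maps preserve relatively uniform limits,
  and such limits are unique in an Archimedean space, so the set on which the two maps agree is
  relatively uniformly closed; it contains the original space, hence the whole closure.

  One-sided multiplications are order bounded. So if \<open>T\<close> is multiplicative, the principle applies
  to \<open>x \<mapsto> Tbar (x * i b)\<close> and \<open>x \<mapsto> Tbar x * T b\<close>, which agree on the image of \<open>i\<close>; and then,
  for a fixed arbitrary \<open>x\<close>, to \<open>y \<mapsto> Tbar (x * y)\<close> and \<open>y \<mapsto> Tbar x * Tbar y\<close>. The multiplication
  is thus reached one variable at a time. The converse holds because \<open>i\<close> is multiplicative.
\<close>

section \<open>Relatively uniform limits\<close>

lemma abs_le_iff_riesz:
  fixes x y :: "'a::riesz_space"
  shows "\<bar>x\<bar> \<le> y \<longleftrightarrow> x \<le> y \<and> - y \<le> x"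
  by (metis abs_ge_self abs_ge_minus_self abs_leI minus_le_iff order_trans)

lemma abs_le_of_between:
  fixes x l w :: "'a::riesz_space"
  assumes "l \<le> x" "x \<le> w"
  shows "\<bar>x\<bar> \<le> \<bar>l\<bar> + \<bar>w\<bar>"
proof (rule abs_leI)
  show "x \<le> \<bar>l\<bar> + \<bar>w\<bar>"
    using assms(2) abs_ge_self[of w] abs_ge_zero[of l] by (metis add_increasing order_trans)
  have "- x \<le> - l"
    using assms(1) by simp
  then show "- x \<le> \<bar>l\<bar> + \<bar>w\<bar>"
    using abs_ge_minus_self[of l] abs_ge_zero[of w] by (metis add_increasing2 order_trans)
qed

text \<open>The distance between two limits lies below every positive multiple of the sum of their
  regulators, so it vanishes by the Archimedean property.\<close>

lemma ru_limit_unique: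
  fixes x y :: "'a::archimedean_riesz_space"
  assumes "ru_converges X x" "ru_converges X y"
  shows "x = y"
proof -
  obtain u where u: "u \<ge> 0" "\<And>\<epsilon>. \<epsilon> > 0 \<Longrightarrow> \<exists>N. \<forall>n\<ge>N. \<bar>X n - x\<bar> \<le> \<epsilon> *\<^sub>R u"
    using assms(1) unfolding ru_converges_def by blast
  obtain v where v: "v \<ge> 0" "\<And>\<epsilon>. \<epsilon> > 0 \<Longrightarrow> \<exists>N. \<forall>n\<ge>N. \<bar>X n - y\<bar> \<le> \<epsilon> *\<^sub>R v"
    using assms(2) unfolding ru_converges_def by blast
  have small: "\<bar>x - y\<bar> \<le> \<epsilon> *\<^sub>R (u + v)" if \<epsilon>: "\<epsilon> > 0" for \<epsilon> :: real
  proof -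
    obtain M N where "\<forall>n\<ge>M. \<bar>X n - x\<bar> \<le> \<epsilon> *\<^sub>R u" "\<forall>n\<ge>N. \<bar>X n - y\<bar> \<le> \<epsilon> *\<^sub>R v"
      using u(2)[OF \<epsilon>] v(2)[OF \<epsilon>] by blast
    then have n: "\<bar>X (max M N) - x\<bar> \<le> \<epsilon> *\<^sub>R u" "\<bar>X (max M N) - y\<bar> \<le> \<epsilon> *\<^sub>R v"
      by simp_all
    have "\<bar>x - y\<bar> = \<bar>(X (max M N) - y) - (X (max M N) - x)\<bar>"
      by simp
    also have "\<dots> \<le> \<bar>X (max M N) - y\<bar> + \<bar>X (max M N) - x\<bar>"
      by (rule abs_triangle_ineq4)
    also have "\<dots> \<le> \<epsilon> *\<^sub>R v + \<epsilon> *\<^sub>R u"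
      using n by (intro add_mono)
    finally show ?thesis
      by (simp add: scaleR_add_right add.commute)
  qed
  have "real n *\<^sub>R \<bar>x - y\<bar> \<le> u + v" for n
  proof (cases "n = 0")
    case True
    then show ?thesis using u(1) v(1) by simp
  next
    case False
    then have "\<bar>x - y\<bar> \<le> (1 / real n) *\<^sub>R (u + v)"
      by (intro small) simp
    then have "real n *\<^sub>R \<bar>x - y\<bar> \<le> real n *\<^sub>R ((1 / real n) *\<^sub>R (u + v))"
      by (rule scaleR_left_mono) simp
    then show ?thesis using False by simp
  qed
  then have "\<bar>x - y\<bar> = 0"
    by (intro archimedean[of "\<bar>x - y\<bar>" "u + v"]) simp_all
  then show ?thesis by simp
qed

text \<open>By linearity, a bound for the image of the order interval from \<open>- u\<close> to \<open>u\<close> is a regulator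
  for the image of every sequence that converges with regulator \<open>u\<close>.\<close>

lemma order_bounded_linear_ru_continuous:
  fixes T :: "'a::riesz_space \<Rightarrow> 'b::riesz_space"
  assumes "linear T" "order_bounded T" "ru_converges X x"
  shows "ru_converges (\<lambda>n. T (X n)) (T x)"
proof -
  obtain u where u: "\<And>\<epsilon>. \<epsilon> > 0 \<Longrightarrow> \<exists>N. \<forall>n\<ge>N. \<bar>X n - x\<bar> \<le> \<epsilon> *\<^sub>R u"
    using assms(3) unfolding ru_converges_def by blast
  obtain l w where lw: "T ` {- u..u} \<subseteq> {l..w}"
    using assms(2) unfolding order_bounded_def by blast
  have bound: "\<bar>T z\<bar> \<le> \<epsilon> *\<^sub>R (\<bar>l\<bar> + \<bar>w\<bar>)" if \<epsilon>: "\<epsilon> > 0" and z: "\<bar>z\<bar> \<le> \<epsilon> *\<^sub>R u" for \<epsilon> z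
  proof -
    define z' where "z' = (1 / \<epsilon>) *\<^sub>R z"
    have z_eq: "z = \<epsilon> *\<^sub>R z'"
      using \<epsilon> by (simp add: z'_def)
    have "z \<le> \<epsilon> *\<^sub>R u" "- (\<epsilon> *\<^sub>R u) \<le> z"
      using z unfolding abs_le_iff_riesz by simp_all
    then have "(1 / \<epsilon>) *\<^sub>R z \<le> (1 / \<epsilon>) *\<^sub>R (\<epsilon> *\<^sub>R u)"
        "(1 / \<epsilon>) *\<^sub>R (- (\<epsilon> *\<^sub>R u)) \<le> (1 / \<epsilon>) *\<^sub>R z"
      using \<epsilon> by (intro scaleR_left_mono; simp)+
    then have "z' \<in> {- u..u}"
      using \<epsilon> by (simp add: z'_def)
    then have "T z' \<in> {l..w}"
      using lw by blast
    then have "\<bar>T z'\<bar> \<le> \<bar>l\<bar> + \<bar>w\<bar>"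
      by (intro abs_le_of_between) simp_all
    then have "T z' \<le> \<bar>l\<bar> + \<bar>w\<bar>" "- (\<bar>l\<bar> + \<bar>w\<bar>) \<le> T z'"
      unfolding abs_le_iff_riesz by simp_all
    then have "\<epsilon> *\<^sub>R T z' \<le> \<epsilon> *\<^sub>R (\<bar>l\<bar> + \<bar>w\<bar>)" "\<epsilon> *\<^sub>R (- (\<bar>l\<bar> + \<bar>w\<bar>)) \<le> \<epsilon> *\<^sub>R T z'"
      using \<epsilon> by (intro scaleR_left_mono; simp)+
    then show ?thesis
      unfolding z_eq linear_scale[OF assms(1)] abs_le_iff_riesz scaleR_minus_right by blast
  qed
  show ?thesis
    unfolding ru_converges_def linear_diff[OF assms(1), symmetric]
  proof (intro exI[of _ "\<bar>l\<bar> + \<bar>w\<bar>"] conjI allI impI)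
    show "\<exists>N. \<forall>n\<ge>N. \<bar>T (X n - x)\<bar> \<le> \<epsilon> *\<^sub>R (\<bar>l\<bar> + \<bar>w\<bar>)" if "\<epsilon> > 0" for \<epsilon>
      using u[OF that] bound[OF that] by blast
  qed simp
qed

lemma ru_closed_hull: "ru_closed (ru_closed hull S)"
proof (rule hull_in)
  fix F :: "'a set set" assume F: "Ball F ru_closed"
  show "ru_closed (\<Inter>F)"
    unfolding ru_closed_def
  proof (intro allI impI InterI)
    fix X x C assume X: "\<forall>n. X n \<in> \<Inter>F" "ru_converges X x" and C: "C \<in> F"
    have "ru_closed C"
      using F C by (rule bspec)
    moreover have "\<forall>n. X n \<in> C"
      using X(1) C by simp
    ultimately show "x \<in> C"
      using X(2) unfolding ru_closed_def by blast
  qed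
qed

section \<open>Order bounded maps on the completion\<close>

lemma riesz_embedding_le_iff:
  assumes "riesz_embedding f"
  shows "f x \<le> f y \<longleftrightarrow> x \<le> y"
  using assms unfolding riesz_embedding_def by (metis injD le_iff_inf)

lemma riesz_embedding_abs:
  assumes "riesz_embedding f"
  shows "f \<bar>x\<bar> = \<bar>f x\<bar>"
  using assms by (simp add: riesz_embedding_def abs_lattice linear_neg)

text \<open>The relatively uniform closure is formed with regulators in the ambient space. When the
  embedded space is majorizing, every regulator can be enlarged to one in the image of \<open>e\<close>, so
  convergence in the ambient space can be pulled back.\<close>

lemma ru_converges_reflect:
  assumes e: "riesz_embedding e" and maj: "\<And>v. \<exists>c. v \<le> e c"
    and conv: "ru_converges (\<lambda>n. e (Y n)) (e y)"
  shows "ru_converges Y y"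
proof -
  have lin: "linear e"
    using e by (simp add: riesz_embedding_def)
  obtain u where u: "u \<ge> 0" "\<And>\<epsilon>. \<epsilon> > 0 \<Longrightarrow> \<exists>N. \<forall>n\<ge>N. \<bar>e (Y n) - e y\<bar> \<le> \<epsilon> *\<^sub>R u"
    using conv unfolding ru_converges_def by blast
  obtain c where c: "u \<le> e c"
    using maj by blast
  have "e 0 \<le> e c"
    using u(1) c linear_0[OF lin] by simp
  then have "0 \<le> c"
    by (simp add: riesz_embedding_le_iff[OF e])
  moreover have "\<exists>N. \<forall>n\<ge>N. \<bar>Y n - y\<bar> \<le> \<epsilon> *\<^sub>R c" if \<epsilon>: "\<epsilon> > 0" for \<epsilon>
  proof -
    have "\<bar>Y n - y\<bar> \<le> \<epsilon> *\<^sub>R c" if "\<bar>e (Y n) - e y\<bar> \<le> \<epsilon> *\<^sub>R u" for n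
    proof -
      have "e \<bar>Y n - y\<bar> = \<bar>e (Y n) - e y\<bar>"
        by (simp add: riesz_embedding_abs[OF e] linear_diff[OF lin])
      also have "\<dots> \<le> \<epsilon> *\<^sub>R u"
        by (rule that)
      also have "\<dots> \<le> \<epsilon> *\<^sub>R e c"
        using c \<epsilon> by (intro scaleR_left_mono) simp_all
      also have "\<dots> = e (\<epsilon> *\<^sub>R c)"
        by (simp add: linear_scale[OF lin])
      finally show ?thesis
        by (simp only: riesz_embedding_le_iff[OF e])
    qed
    then show ?thesis using u(2)[OF \<epsilon>] by blast
  qed
  ultimately show ?thesis
    unfolding ru_converges_def by blast
qed

text \<open>Order bounded linear extensions to the relatively uniform completion are unique. The closure
  need not be exhausted by limits of sequences from the original space, so the argument shows
  that the set of agreement is closed instead of approximating single elements.\<close>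

lemma order_bounded_linear_eqI:
  fixes U V :: "'c::riesz_space \<Rightarrow> 'b::archimedean_riesz_space"
  assumes compl: "ru_completion i e"
    and U: "linear U" "order_bounded U" and V: "linear V" "order_bounded V"
    and agree: "\<And>a. U (i a) = V (i a)"
  shows "U x = V x"
proof -
  have e: "riesz_embedding e" and hull: "range e = ru_closed hull range (e \<circ> i)"
    using compl by (simp_all add: ru_completion_def)
  have maj: "\<exists>c. v \<le> e c" for v
    using compl by (auto simp: ru_completion_def dedekind_completion_def)
  let ?E = "e ` {x. U x = V x}"
  have "ru_closed ?E"
    unfolding ru_closed_def
  proof (intro allI impI)
    fix X z assume X: "\<forall>n. X n \<in> ?E" and conv: "ru_converges X z"
    from X obtain Y where Y: "\<And>n. X n = e (Y n)" "\<And>n. U (Y n) = V (Y n)"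
      by (simp add: image_iff) metis
    have "ru_closed (range e)"
      unfolding hull by (rule ru_closed_hull)
    moreover have "\<forall>n. X n \<in> range e"
      using Y(1) by simp
    ultimately have "z \<in> range e"
      using conv unfolding ru_closed_def by blast
    then obtain y where z: "z = e y"
      by blast
    have "X = (\<lambda>n. e (Y n))"
      using Y(1) by blast
    then have "ru_converges Y y"
      using conv z by (intro ru_converges_reflect[OF e maj]) simp
    then have "ru_converges (\<lambda>n. U (Y n)) (U y)" "ru_converges (\<lambda>n. V (Y n)) (V y)"
      using order_bounded_linear_ru_continuous[OF U] order_bounded_linear_ru_continuous[OF V]
      by blast+
    then have "U y = V y"
      unfolding Y(2) by (rule ru_limit_unique)
    then show "z \<in> ?E"
      using z by simp
  qed
  moreover have "range (e \<circ> i) \<subseteq> ?E"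
    using agree by auto
  ultimately have "range e \<subseteq> ?E"
    unfolding hull by (intro hull_minimal)
  moreover have "inj e"
    using e by (simp add: riesz_embedding_def)
  ultimately show ?thesis
    by (auto dest: injD)
qed

section \<open>Multiplication operators\<close>

lemma order_bounded_comp:
  assumes "order_bounded S" "order_bounded T"
  shows "order_bounded (\<lambda>x. S (T x))"
  using assms unfolding order_bounded_def image_subset_iff by meson

lemma order_bounded_if_abs_le:
  fixes T :: "'a::riesz_space \<Rightarrow> 'b::riesz_space"
  assumes "\<And>x. \<bar>T x\<bar> \<le> P \<bar>x\<bar>" and "\<And>x y. x \<le> y \<Longrightarrow> P x \<le> P y"
  shows "order_bounded T"
  unfolding order_bounded_def
proof (intro allI)
  fix u v :: 'a
  have "\<bar>T x\<bar> \<le> P (\<bar>u\<bar> + \<bar>v\<bar>)" if "x \<in> {u..v}" for x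
    using assms(1)[of x] assms(2)[OF abs_le_of_between[of u x v]] that by auto
  then have "T ` {u..v} \<subseteq> {- P (\<bar>u\<bar> + \<bar>v\<bar>)..P (\<bar>u\<bar> + \<bar>v\<bar>)}"
    by (auto simp: abs_le_iff_riesz)
  then show "\<exists>l w. T ` {u..v} \<subseteq> {l..w}"
    by blast
qed

lemma order_bounded_mult_right: "order_bounded (\<lambda>x::'a::riesz_algebra. x * c)"
  by (rule order_bounded_if_abs_le[where P = "\<lambda>x. x * \<bar>c\<bar>"])
    (rule abs_le_mult mult_right_mono abs_ge_zero | assumption)+

lemma order_bounded_mult_left: "order_bounded (\<lambda>x::'a::riesz_algebra. c * x)"
  by (rule order_bounded_if_abs_le[where P = "\<lambda>x. \<bar>c\<bar> * x"])
    (rule abs_le_mult mult_left_mono abs_ge_zero | assumption)+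

lemma linear_mult_right: "linear (\<lambda>x::'a::real_algebra. x * c)"
  by (rule linearI) (simp_all add: distrib_right)

lemma linear_mult_left: "linear (\<lambda>x::'a::real_algebra. c * x)"
  by (rule linearI) (simp_all add: distrib_left)

lemma linear_comp:
  assumes "linear S" "linear T"
  shows "linear (\<lambda>x. S (T x))"
  using linear_compose[OF assms(2,1)] by (simp add: comp_def)

section \<open>Multiplicativity of the extension\<close>

theorem proposition4:
  fixes T :: "'a::{f_algebra, archimedean_riesz_space} \<Rightarrow>
              'b::{f_algebra, archimedean_riesz_space, ru_complete_riesz_space}"
    and i :: "'a \<Rightarrow> 'c::riesz_algebra"
    and e :: "'c \<Rightarrow> 'd::{riesz_space, conditionally_complete_lattice}"
    and Tbar :: "'c \<Rightarrow> 'b"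
  assumes "linear T" and "order_bounded T"
    and "ru_completion_algebra i e"
    and "order_bounded_extension i T Tbar"
  shows "algebra_hom T \<longleftrightarrow> algebra_hom Tbar"
proof -
  have compl: "ru_completion i e" and i_mult: "\<And>a b. i (a * b) = i a * i b"
    using assms(3) by (simp_all add: ru_completion_algebra_def)
  have lin: "linear Tbar" and bdd: "order_bounded Tbar" and "Tbar \<circ> i = T"
    using assms(4) by (simp_all add: order_bounded_extension_def)
  then have ext: "Tbar (i a) = T a" for a
    by auto
  show ?thesis
  proof
    assume "algebra_hom Tbar"
    then have "T (a * b) = T a * T b" for a b
      by (simp add: algebra_hom_def i_mult flip: ext)
    then show "algebra_hom T"
      using assms(1) by (simp add: algebra_hom_def)
  next
    assume "algebra_hom T"
    then have T_mult: "T (a * b) = T a * T b" for a b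
      by (simp add: algebra_hom_def)
    have half: "Tbar (x * i b) = Tbar x * Tbar (i b)" for x b
    proof (rule order_bounded_linear_eqI[OF compl, where x = x])
      show "linear (\<lambda>x. Tbar (x * i b))"
        by (rule linear_comp[OF lin linear_mult_right])
      show "order_bounded (\<lambda>x. Tbar (x * i b))"
        by (rule order_bounded_comp[OF bdd order_bounded_mult_right])
      show "linear (\<lambda>x. Tbar x * Tbar (i b))"
        by (rule linear_comp[OF linear_mult_right lin])
      show "order_bounded (\<lambda>x. Tbar x * Tbar (i b))"
        by (rule order_bounded_comp[OF order_bounded_mult_right bdd])
      show "Tbar (i a * i b) = Tbar (i a) * Tbar (i b)" for a
        by (simp add: ext T_mult flip: i_mult)
    qed
    have "Tbar (x * y) = Tbar x * Tbar y" for x y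
    proof (rule order_bounded_linear_eqI[OF compl, where x = y])
      show "linear (\<lambda>y. Tbar (x * y))"
        by (rule linear_comp[OF lin linear_mult_left])
      show "order_bounded (\<lambda>y. Tbar (x * y))"
        by (rule order_bounded_comp[OF bdd order_bounded_mult_left])
      show "linear (\<lambda>y. Tbar x * Tbar y)"
        by (rule linear_comp[OF linear_mult_left lin])
      show "order_bounded (\<lambda>y. Tbar x * Tbar y)"
        by (rule order_bounded_comp[OF order_bounded_mult_left bdd])
      show "Tbar (x * i b) = Tbar x * Tbar (i b)" for b
        by (rule half)
    qed
    then show "algebra_hom Tbar"
      using lin by (simp add: algebra_hom_def)
  qed
qed

end
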